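(* Let $k\geq 2$ be an integer. Then there exists $p_0=p_0(k)$ such that the following holds for every positive integer $n$: if $p>p_0$ is a prime and $M_1,\dots,M_k\in\mathbb{F}_p^{n\times n}$ are invertible matrices, then there exists $x\in\mathbb{F}_p^n$ such that none of the vectors $M_1x,\dots,M_kx$ has a zero coordinate. *)

theory Defs
  imports "HOL-Number_Theory.Residues" "Jordan_Normal_Form.Matrix"
begin

text \<open>
  The field with \<open>p\<close> elements has to depend on a number \<open>p\<close> that is quantified inside the
  statement, so it is the HOL-Algebra ring \<^term>\<open>residue_ring (int p)\<close>, with carrier
  \<open>{0..int p - 1}\<close>, and not a type. The types \<^typ>\<open>'a vec\<close> and \<^typ>\<open>'a mat\<close> serve only as
  containers: their own arithmetic is that of the type \<open>'a\<close>, so the operations below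
  are defined from the operations of the ring record instead.
\<close>

definition ring_vecs :: "('a, 'b) ring_scheme \<Rightarrow> nat \<Rightarrow> 'a vec set" where
  "ring_vecs R n = {x \<in> carrier_vec n. \<forall>i<n. x $ i \<in> carrier R}"

definition ring_mats :: "('a, 'b) ring_scheme \<Rightarrow> nat \<Rightarrow> 'a mat set" where
  "ring_mats R n = {A \<in> carrier_mat n n. \<forall>i<n. \<forall>j<n. A $$ (i, j) \<in> carrier R}"

definition ring_mat_vec :: "('a, 'b) ring_scheme \<Rightarrow> 'a mat \<Rightarrow> 'a vec \<Rightarrow> 'a vec" where
  "ring_mat_vec R A x =
     vec (dim_row A) (\<lambda>i. \<Oplus>\<^bsub>R\<^esub>j\<in>{..<dim_col A}. A $$ (i, j) \<otimes>\<^bsub>R\<^esub> x $ j)"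

definition ring_mat_mult :: "('a, 'b) ring_scheme \<Rightarrow> 'a mat \<Rightarrow> 'a mat \<Rightarrow> 'a mat" where
  "ring_mat_mult R A B =
     mat (dim_row A) (dim_col B)
       (\<lambda>(i, j). \<Oplus>\<^bsub>R\<^esub>l\<in>{..<dim_col A}. A $$ (i, l) \<otimes>\<^bsub>R\<^esub> B $$ (l, j))"

definition ring_mat_one :: "('a, 'b) ring_scheme \<Rightarrow> nat \<Rightarrow> 'a mat" where
  "ring_mat_one R n = mat n n (\<lambda>(i, j). if i = j then \<one>\<^bsub>R\<^esub> else \<zero>\<^bsub>R\<^esub>)"

text \<open>The invertible matrices are the \<^const>\<open>Units\<close> of this monoid.\<close>

definition mat_monoid :: "('a, 'b) ring_scheme \<Rightarrow> nat \<Rightarrow> 'a mat monoid" where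
  "mat_monoid R n =
     \<lparr>carrier = ring_mats R n, monoid.mult = ring_mat_mult R, monoid.one = ring_mat_one R n\<rparr>"

end

theory Submission
  imports Defs "HOL-Library.FuncSet" "HOL-Real_Asymp.Real_Asymp"
begin

text \<open>
  If no good \<open>x\<close> exists, the hyperplanes orthogonal to the rows of the \<open>M\<^sub>i\<close> cover the whole space; pass to
  an irredundant subcover with rows \<open>v\<^sub>i\<close>, \<open>i \<in> I\<close>. Let \<open>A\<close> be a set of \<open>O(log p)\<close> residues in
  which every element is the midpoint of two others. The set of combinations \<open>\<Sum> w\<^sub>i v\<^sub>i\<close> with all
  \<open>w\<^sub>i \<in> A\<close> turns out to be invariant under translation by every \<open>c v\<^sub>j\<close>: any point with
  \<open>\<langle>v\<^sub>i, x\<rangle> \<noteq> 0\<close> for all \<open>i \<noteq> j\<close> satisfies \<open>\<langle>v\<^sub>j, x\<rangle> = 0\<close>, which makes the Fourier transform of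
  \<open>\<Prod>\<^bsub>i \<noteq> j\<^esub> (1 - e(d\<^sub>i \<langle>v\<^sub>i, x\<rangle>))\<close>, a signed count of the subset sums of the \<open>d\<^sub>i v\<^sub>i\<close>, constant
  along \<open>v\<^sub>j\<close>. So the set contains a translate of the span of the \<open>v\<^sub>j\<close>. Some matrix contributes
  at least \<open>|I| / k\<close> of the rows, and these are independent, whence \<open>p\<^bsup>|I|/k\<^esup> \<le> |A|\<^bsup>|I|\<^esup>\<close>. This
  bounds \<open>p\<close> by \<open>O(log p)\<^sup>k\<close>.
\<close>

section \<open>Small balanced sets of residues\<close>

text \<open>Elements stand for their classes modulo \<open>m\<close>, and \<open>d\<close> may
  depend on \<open>a\<close>. The condition that \<open>m\<close> does not divide \<open>d\<close>
  excludes the trivial midpoint; for prime \<open>m\<close> it makes \<open>1 - e(d * y)\<close>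
  vanish only when \<open>m\<close> divides \<open>y\<close>.\<close>

definition balanced_mod :: "int \<Rightarrow> int set \<Rightarrow> bool" where
  "balanced_mod m A \<longleftrightarrow>
     (\<forall>a\<in>A. \<exists>d. \<not> m dvd d \<and> (\<exists>b\<in>A. [b = a + d] (mod m)) \<and> (\<exists>b\<in>A. [b = a - d] (mod m)))"

text \<open>
  The set consists of \<open>\<plusminus> \<lfloor>N / 2\<^sup>i\<rfloor>\<close> for \<open>p = 2N + 1\<close>: if \<open>y = 2a + b\<close> with
  \<open>a = \<lfloor>y / 2\<rfloor>\<close>, then \<open>a\<close> is the midpoint of \<open>y\<close> and \<open>- b\<close>; and \<open>N\<close> is that of \<open>- 1 \<equiv> 2N\<close> and \<open>0\<close>.
\<close>

lemma small_balanced_set: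
  assumes "odd p" "p > 1"
  obtains A r where "balanced_mod (int p) A" "finite A" "A \<noteq> {}"
    "card A \<le> 2 * (r + 1)" "2 ^ r \<le> p" "p < 2 ^ (r + 1)"
proof -
  from \<open>odd p\<close> obtain N where N: "p = 2 * N + 1" by (elim oddE)
  with \<open>p > 1\<close> have "N \<ge> 1" by simp
  then obtain s where s: "2 ^ s \<le> N" "N < 2 ^ (s + 1)"
    using ex_power_ivl1[of 2 N] by auto
  \<comment> \<open>As \<open>p = 2 * N + 1\<close>, this \<open>r\<close> is the floor of the
    binary logarithm of \<open>p\<close>. It is also the first exponent at which the halvings of
    \<open>N\<close>, having passed through 1, reach 0.\<close>
  define r where "r = s + 1"
  define P where "P = (\<lambda>i. int (N div 2 ^ i)) ` {..r}"
  define A where "A = P \<union> uminus ` P"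
  have P_I: "int (N div 2 ^ i) \<in> P" if "i \<le> r" for i using that by (auto simp: P_def)
  have "N div 2 ^ r = 0" using s by (simp add: r_def)
  then have P0: "0 \<in> P" using P_I[of r] by simp
  have "N div 2 ^ s = 1"
    using s by (intro div_nat_eqI) auto
  then have P1: "1 \<in> P" using P_I[of s] by (simp add: r_def)
  have PN: "int N \<in> P" using P_I[of 0] by simp
  have main: "\<exists>d. \<not> int p dvd d \<and> (\<exists>b\<in>A. [b = a + d] (mod int p)) \<and> (\<exists>b\<in>A. [b = a - d] (mod int p))"
    if "a \<in> P" for a
  proof -
    from that obtain i where i: "i \<le> r" "a = int (N div 2 ^ i)" by (auto simp: P_def)
    have nd: "\<not> int p dvd d" if "0 < d" "d \<le> int N" for d
      using that N zdvd_imp_le[of "int p" d] by auto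
    consider "a = 0" | "a > 0" "i = 0" | j where "a > 0" "i = Suc j"
      using i by (cases i) auto
    then show ?thesis
    proof cases
      case 1
      have "int N \<in> A" "- int N \<in> A" using PN by (auto simp: A_def)
      with 1 show ?thesis
        using nd[of "int N"] \<open>N \<ge> 1\<close>
        by (intro exI[of _ "int N"] conjI bexI[of _ "int N"] bexI[of _ "- int N"]) auto
    next
      case 2
      then have a: "a = int N" using i by simp
      have "a + int N = - 1 + int p" by (simp add: a N)
      then have "[- 1 = a + int N] (mod int p)" by (simp add: Cong.cong_def)
      moreover have "- 1 \<in> A" using P1 by (auto simp: A_def)
      moreover have "[0 = a - int N] (mod int p)" "0 \<in> A" using a P0 by (auto simp: A_def)
      ultimately show ?thesis
        using nd[of "int N"] \<open>N \<ge> 1\<close> by (intro exI[of _ "int N"]) auto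
    next
      case (3 j)
      define y where "y = N div 2 ^ j"
      have ay: "a = int (y div 2)" using 3 i by (simp add: y_def div_mult2_eq[symmetric] mult.commute)
      define b where "b = int (y mod 2)"
      have y: "int y = 2 * a + b" unfolding ay b_def by presburger
      have b: "b = 0 \<or> b = 1" unfolding b_def by auto
      have "y \<le> N" by (simp add: y_def)
      have "int y \<in> A" using P_I[of j] i 3 by (auto simp: A_def y_def)
      moreover have "- b \<in> A" using b P0 P1 by (auto simp: A_def)
      \<comment> \<open>The difference \<open>a + b\<close> is positive and at most
        \<open>2 * a + b = y\<close>, hence at most \<open>N\<close>, so \<open>p\<close> does not
        divide it.\<close>
      ultimately show ?thesis
        using nd[of "a + b"] b y 3 \<open>y \<le> N\<close>
        by (intro exI[of _ "a + b"] conjI bexI[of _ "int y"] bexI[of _ "- b"]) auto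
    qed
  qed
  have "balanced_mod (int p) A"
    unfolding balanced_mod_def
  proof
    fix a assume "a \<in> A"
    then consider "a \<in> P" | "- a \<in> P" by (auto simp: A_def)
    then show "\<exists>d. \<not> int p dvd d \<and> (\<exists>b\<in>A. [b = a + d] (mod int p)) \<and> (\<exists>b\<in>A. [b = a - d] (mod int p))"
    proof cases
      case 1 then show ?thesis by (rule main)
    next
      case 2
      from main[OF this] obtain d b c where d: "\<not> int p dvd d"
        "b \<in> A" "[b = - a + d] (mod int p)" "c \<in> A" "[c = - a - d] (mod int p)" by blast
      have "- b \<in> A" "- c \<in> A" using d by (auto simp: A_def)
      moreover have "[- c = a + d] (mod int p)" "[- b = a - d] (mod int p)"
        using d(3,5) cong_minus_minus_iff[of b "- a + d"] cong_minus_minus_iff[of c "- a - d"]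
        by (simp_all add: algebra_simps)
      ultimately show ?thesis using d(1) by blast
    qed
  qed
  moreover have "finite A" by (simp add: A_def P_def)
  moreover have "A \<noteq> {}" using P0 by (auto simp: A_def)
  moreover have "card A \<le> 2 * (r + 1)"
  proof -
    have "finite P" by (simp add: P_def)
    have "card A \<le> card P + card (uminus ` P)" unfolding A_def by (rule card_Un_le)
    also have "\<dots> \<le> card P + card P" using \<open>finite P\<close> by (intro add_left_mono card_image_le)
    also have "card P \<le> card {..r}" unfolding P_def by (intro card_image_le) simp
    finally show ?thesis by simp
  qed
  moreover have "2 ^ r \<le> p" "p < 2 ^ (r + 1)" using s N by (auto simp: r_def)
  ultimately show ?thesis by (rule that)
qed

section \<open>Additive characters modulo \<open>p\<close> and their orthogonality\<close>

definition add_char :: "nat \<Rightarrow> int \<Rightarrow> complex" where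
  "add_char p m = cis (2 * pi * of_int m / of_nat p)"

lemma add_char_add: "add_char p (a + b) = add_char p a * add_char p b"
  by (simp add: add_char_def cis_mult distrib_left add_divide_distrib)

lemma add_char_0 [simp]: "add_char p 0 = 1"
  by (simp add: add_char_def)

lemma add_char_minus: "add_char p (- a) = cnj (add_char p a)"
  by (simp add: add_char_def cis_cnj)

lemma add_char_sum: "add_char p (\<Sum>i\<in>A. f i) = (\<Prod>i\<in>A. add_char p (f i))"
  by (induction A rule: infinite_finite_induct) (simp_all add: add_char_add)

lemma add_char_mult_of_nat: "add_char p (a * int j) = add_char p a ^ j"
  by (induction j) (simp_all add: add_char_add algebra_simps)

lemma add_char_eq_1_iff:
  assumes "p > 0"
  shows "add_char p m = 1 \<longleftrightarrow> int p dvd m"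
proof
  assume "add_char p m = 1"
  then have "cos (2 * pi * of_int m / of_nat p) = 1"
    by (simp add: add_char_def complex_eq_iff)
  then obtain k :: int where "2 * pi * of_int m / of_nat p = of_int k * 2 * pi"
    by (auto simp: cos_one_2pi_int)
  then have "(of_int m :: real) = of_int (k * int p)" using assms by (simp add: field_simps)
  then have "m = k * int p" by (simp only: of_int_eq_iff)
  then show "int p dvd m" by simp
next
  assume "int p dvd m"
  then obtain k where "m = int p * k" by (elim dvdE)
  then show "add_char p m = 1"
    using assms cis_multiple_2pi[of "of_int k"] by (simp add: add_char_def mult.assoc)
qed

lemma sum_add_char:
  assumes "p > 0"
  shows "(\<Sum>j\<in>{0..<int p}. add_char p (a * j)) = (if int p dvd a then of_nat p else 0)"
proof -
  have "(\<Sum>j\<in>{0..<int p}. add_char p (a * j)) = (\<Sum>j<p. add_char p a ^ j)"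
    by (rule sum.reindex_bij_witness[of _ int nat]) (auto simp flip: add_char_mult_of_nat)
  also have "\<dots> = (if int p dvd a then of_nat p else 0)"
  proof (cases "int p dvd a")
    case True
    then have "add_char p a = 1" using assms by (simp add: add_char_eq_1_iff)
    then show ?thesis using True by simp
  next
    case False
    then have "add_char p a \<noteq> 1" using assms by (simp add: add_char_eq_1_iff)
    moreover have "add_char p a ^ p = 1"
      unfolding add_char_mult_of_nat[symmetric] using assms by (simp add: add_char_eq_1_iff)
    ultimately show ?thesis using False by (simp add: geometric_sum)
  qed
  finally show ?thesis .
qed

lemma sum_add_char_PiE:
  assumes "p > 0" "finite T"
  shows "(\<Sum>x\<in>PiE T (\<lambda>_. {0..<int p}). add_char p (\<Sum>t\<in>T. z t * x t)) =
    (if \<forall>t\<in>T. int p dvd z t then of_nat p ^ card T else 0)"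
proof -
  have "(\<Sum>x\<in>PiE T (\<lambda>_. {0..<int p}). add_char p (\<Sum>t\<in>T. z t * x t)) =
      (\<Prod>t\<in>T. \<Sum>j\<in>{0..<int p}. add_char p (z t * j))"
    using assms by (simp add: add_char_sum prod_sum_PiE)
  also have "\<dots> = (if \<forall>t\<in>T. int p dvd z t then of_nat p ^ card T else 0)"
    using assms by (auto simp: sum_add_char)
  finally show ?thesis .
qed

section \<open>Periodicity of subset sums and translation invariance\<close>

text \<open>The signed count of subsets with a given sum is, up to a constant factor, the Fourier
  transform \<open>K\<close> of a product \<open>H\<close>. Since \<open>H\<close> is supported
  where \<open>u\<close> pairs to 0, \<open>K\<close> is constant along \<open>u\<close>. Once
  \<open>K\<close> is nonzero at one subset sum, it is nonzero on the whole line through it, and so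
  every point of that line is a subset sum.\<close>

lemma sum_subsets_periodic:
  fixes v :: "'i \<Rightarrow> 't \<Rightarrow> int"
  assumes p: "prime p" and fin: "finite I" "finite T"
    and d: "\<And>i. i \<in> I \<Longrightarrow> \<not> int p dvd d i"
    and ex: "\<exists>x. \<forall>i\<in>I. \<not> int p dvd (\<Sum>t\<in>T. v i t * x t)"
    and van: "\<And>x. \<forall>i\<in>I. \<not> int p dvd (\<Sum>t\<in>T. v i t * x t) \<Longrightarrow> int p dvd (\<Sum>t\<in>T. u t * x t)"
  shows "\<exists>S0\<subseteq>I. \<forall>c. \<exists>S\<subseteq>I. \<forall>t\<in>T.
    [(\<Sum>i\<in>S. d i * v i t) = (\<Sum>i\<in>S0. d i * v i t) + c * u t] (mod int p)"
proof -
  have p0: "p > 0" using p by (simp add: prime_gt_0_nat)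
  define ip where "ip a x = (\<Sum>t\<in>T. a t * x t)" for a x :: "'t \<Rightarrow> int"
  define X where "X = PiE T (\<lambda>_. {0..<int p})"
  define Y where "Y S t = (\<Sum>i\<in>S. d i * v i t)" for S t
  define H where "H x = (\<Prod>i\<in>I. 1 - add_char p (d i * ip (v i) x))" for x
  define K where "K y = (\<Sum>x\<in>X. H x * add_char p (- ip y x))" for y
  have finX: "finite X" unfolding X_def using fin by (intro finite_PiE) auto
  have ip_diff: "ip (\<lambda>t. a t - b t) x = ip a x - ip b x" for a b x
    by (simp add: ip_def algebra_simps sum_subtractf)
  have ip_Y: "ip (Y S) x = (\<Sum>i\<in>S. d i * ip (v i) x)" for S x
    unfolding ip_def Y_def sum_distrib_left sum_distrib_right
    by (subst sum.swap) (simp add: mult.assoc)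
  have H_nz: "H x \<noteq> 0 \<longleftrightarrow> (\<forall>i\<in>I. \<not> int p dvd ip (v i) x)" for x
    using d p fin by (auto simp: H_def add_char_eq_1_iff p0 prime_dvd_mult_iff)
  have H_sum: "H x = (\<Sum>S\<in>Pow I. (- 1) ^ card S * add_char p (ip (Y S) x))" for x
    unfolding H_def prod_diff_conv_sum[OF fin(1)] ip_Y add_char_sum by simp
  \<comment> \<open>Orthogonality: \<open>K y\<close> is \<open>p ^ card T\<close> times the number
    of \<open>S\<close> with \<open>Y S\<close> congruent to \<open>y\<close>, each counted with
    sign \<open>(- 1) ^ card S\<close>.\<close>
  have K_sum: "K y = (\<Sum>S\<in>Pow I. (- 1) ^ card S *
      (if \<forall>t\<in>T. int p dvd Y S t - y t then of_nat p ^ card T else 0))" for y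
  proof -
    have "K y = (\<Sum>x\<in>X. \<Sum>S\<in>Pow I. (- 1) ^ card S * add_char p (ip (\<lambda>t. Y S t - y t) x))"
      unfolding K_def H_sum sum_distrib_right ip_diff
      by (simp add: add_char_add[symmetric] mult.assoc)
    also have "\<dots> = (\<Sum>S\<in>Pow I. (- 1) ^ card S * (\<Sum>x\<in>X. add_char p (ip (\<lambda>t. Y S t - y t) x)))"
      by (subst sum.swap) (simp add: sum_distrib_left)
    also have "\<dots> = (\<Sum>S\<in>Pow I. (- 1) ^ card S *
      (if \<forall>t\<in>T. int p dvd Y S t - y t then of_nat p ^ card T else 0))"
      unfolding X_def ip_def sum_add_char_PiE[OF p0 fin(2)] ..
    finally show ?thesis .
  qed
  have K_per: "K (\<lambda>t. y t + c * u t) = K y" for y c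
    unfolding K_def
  proof (rule sum.cong[OF refl])
    fix x assume "x \<in> X"
    show "H x * add_char p (- ip (\<lambda>t. y t + c * u t) x) = H x * add_char p (- ip y x)"
    proof (cases "H x = 0")
      case False
      then have "int p dvd ip u x" using van H_nz by (simp add: ip_def)
      then have "add_char p (- (c * ip u x)) = 1" by (simp add: add_char_eq_1_iff p0)
      moreover have "- ip (\<lambda>t. y t + c * u t) x = - ip y x + - (c * ip u x)"
        by (simp add: ip_def algebra_simps sum.distrib sum_distrib_left)
      ultimately show ?thesis by (simp only: add_char_add mult_1_right)
    qed auto
  qed
  have "\<exists>S0\<in>Pow I. K (Y S0) \<noteq> 0"
  proof (rule ccontr)
    assume "\<not> ?thesis"
    \<comment> \<open>A Parseval argument: summing \<open>K (Y S)\<close> with these signs rebuilds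
      \<open>cnj (H x)\<close>, which leaves the sum of the squared moduli of \<open>H\<close>. If
      every \<open>K (Y S)\<close> were 0, then \<open>H\<close> would vanish on \<open>X\<close>,
      against \<open>ex\<close>.\<close>
    then have "0 = (\<Sum>S\<in>Pow I. (- 1) ^ card S * K (Y S))" by simp
    also have "\<dots> = (\<Sum>x\<in>X. H x * (\<Sum>S\<in>Pow I. (- 1) ^ card S * add_char p (- ip (Y S) x)))"
      unfolding K_def sum_distrib_left
      by (subst sum.swap) (simp add: mult_ac)
    also have "\<dots> = (\<Sum>x\<in>X. H x * cnj (H x))"
      by (subst (2) H_sum) (simp add: add_char_minus)
    also have "\<dots> = of_real (\<Sum>x\<in>X. (cmod (H x))\<^sup>2)"
      by (simp only: of_real_sum complex_norm_square)
    finally have "(\<Sum>x\<in>X. (cmod (H x))\<^sup>2) = 0" by (metis of_real_eq_0_iff)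
    then have H0: "\<forall>x\<in>X. H x = 0" using finX by (simp add: sum_nonneg_eq_0_iff)
    from ex obtain x where x: "\<forall>i\<in>I. \<not> int p dvd ip (v i) x" by (auto simp: ip_def)
    define x' where "x' = (\<lambda>t\<in>T. x t mod int p)"
    have "x' \<in> X" using p0 by (auto simp: x'_def X_def)
    have "[ip a x' = ip a x] (mod int p)" for a
      unfolding ip_def x'_def by (intro cong_sum cong_mult) (auto simp: Cong.cong_def)
    then have "\<forall>i\<in>I. \<not> int p dvd ip (v i) x'"
      using x by (simp add: cong_dvd_iff[of _ _ "int p"] Cong.cong_def dvd_eq_mod_eq_0)
    then show False using H0 \<open>x' \<in> X\<close> H_nz by blast
  qed
  then obtain S0 where S0: "S0 \<subseteq> I" "K (Y S0) \<noteq> 0" by auto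
  have "\<exists>S\<subseteq>I. \<forall>t\<in>T. [Y S t = Y S0 t + c * u t] (mod int p)" for c
  proof (rule ccontr)
    assume "\<not> ?thesis"
    then have "K (\<lambda>t. Y S0 t + c * u t) = 0"
      unfolding K_sum cong_iff_dvd_diff by (intro sum.neutral) auto
    then show False using S0 K_per by simp
  qed
  then show ?thesis using S0 unfolding Y_def by blast
qed

text \<open>
  The point \<open>\<Sum> w\<^sub>i v\<^sub>i\<close> is moved by adding \<open>d\<^sub>i v\<^sub>i\<close> for \<open>i \<in> S\<close> and subtracting it for \<open>i \<in> S\<^sub>0\<close>;
  the coefficient of \<open>v\<^sub>i\<close> thus changes by \<open>0\<close> or \<open>\<plusminus> d\<^sub>i\<close> and stays in \<open>A\<close> modulo \<open>p\<close>.
\<close>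

lemma translate_by_element:
  fixes v :: "'i \<Rightarrow> 't \<Rightarrow> int"
  assumes p: "prime p" and fin: "finite I" "finite T"
    and bal: "balanced_mod (int p) A"
    and cover: "\<And>x. \<exists>i\<in>I. int p dvd (\<Sum>t\<in>T. v i t * x t)"
    and j: "j \<in> I" "\<exists>x. \<forall>i\<in>I - {j}. \<not> int p dvd (\<Sum>t\<in>T. v i t * x t)"
    and w: "w \<in> I \<rightarrow> A"
  shows "\<exists>w' \<in> I \<rightarrow> A. \<forall>t\<in>T.
    [(\<Sum>i\<in>I. w' i * v i t) = (\<Sum>i\<in>I. w i * v i t) + c * v j t] (mod int p)"
proof -
  have "\<forall>i\<in>I. \<exists>d a b. \<not> int p dvd d \<and> a \<in> A \<and> b \<in> A \<and>
      [a = w i + d] (mod int p) \<and> [b = w i - d] (mod int p)"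
    using bal w unfolding balanced_mod_def by blast
  then obtain d a b where dab: "\<And>i. i \<in> I \<Longrightarrow> \<not> int p dvd d i \<and> a i \<in> A \<and> b i \<in> A \<and>
      [a i = w i + d i] (mod int p) \<and> [b i = w i - d i] (mod int p)"
    by metis
  \<comment> \<open>A point off all the other hyperplanes must lie on the one of \<open>v j\<close>,
    because the family covers. The sets \<open>S0\<close> and \<open>S\<close> avoid
    \<open>j\<close>, so the shift by \<open>c * v j\<close> is achieved without changing the
    coefficient of \<open>v j\<close>.\<close>
  have "\<exists>S0\<subseteq>I - {j}. \<forall>c. \<exists>S\<subseteq>I - {j}. \<forall>t\<in>T.
      [(\<Sum>i\<in>S. d i * v i t) = (\<Sum>i\<in>S0. d i * v i t) + c * v j t] (mod int p)"
  proof (rule sum_subsets_periodic)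
    fix x assume "\<forall>i\<in>I - {j}. \<not> int p dvd (\<Sum>t\<in>T. v i t * x t)"
    then show "int p dvd (\<Sum>t\<in>T. v j t * x t)" using cover[of x] by blast
  qed (use p fin dab j in auto)
  then obtain S0 where S0: "S0 \<subseteq> I - {j}" "\<exists>S\<subseteq>I - {j}. \<forall>t\<in>T.
      [(\<Sum>i\<in>S. d i * v i t) = (\<Sum>i\<in>S0. d i * v i t) + c * v j t] (mod int p)"
    by metis
  then obtain S where S': "S \<subseteq> I - {j}" "\<forall>t\<in>T.
      [(\<Sum>i\<in>S. d i * v i t) = (\<Sum>i\<in>S0. d i * v i t) + c * v j t] (mod int p)"
    by metis
  have S: "S0 \<subseteq> I" "S \<subseteq> I" and
    S_cong: "\<And>t. t \<in> T \<Longrightarrow> [(\<Sum>i\<in>S. d i * v i t) = (\<Sum>i\<in>S0. d i * v i t) + c * v j t] (mod int p)"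
    using S0(1) S' by auto
  define w' where "w' i = (if i \<in> S - S0 then a i else if i \<in> S0 - S then b i else w i)" for i
  have w'_cong: "[w' i = w i + ((if i \<in> S then d i else 0) - (if i \<in> S0 then d i else 0))] (mod int p)"
    if "i \<in> I" for i
    using dab[OF that] by (auto simp: w'_def)
  have restrict: "(\<Sum>i\<in>I. (if i \<in> B then d i else 0) * v i t) = (\<Sum>i\<in>B. d i * v i t)" if "B \<subseteq> I" for B t
    using that fin by (simp add: if_distrib[of "\<lambda>y. y * _"] sum.inter_restrict[symmetric] Int_absorb1 cong: if_cong)
  show ?thesis
  proof (intro bexI ballI)
    show "w' \<in> I \<rightarrow> A" using dab w by (auto simp: w'_def)
    fix t assume t: "t \<in> T"
    have "[(\<Sum>i\<in>I. w' i * v i t) =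
        (\<Sum>i\<in>I. (w i + ((if i \<in> S then d i else 0) - (if i \<in> S0 then d i else 0))) * v i t)] (mod int p)"
      by (intro cong_sum cong_mult w'_cong) auto
    also have "(\<Sum>i\<in>I. (w i + ((if i \<in> S then d i else 0) - (if i \<in> S0 then d i else 0))) * v i t) =
        (\<Sum>i\<in>I. w i * v i t) + ((\<Sum>i\<in>S. d i * v i t) - (\<Sum>i\<in>S0. d i * v i t))"
      by (simp only: distrib_right left_diff_distrib sum.distrib sum_subtractf restrict S)
    also have "[\<dots> = (\<Sum>i\<in>I. w i * v i t) +
        (((\<Sum>i\<in>S0. d i * v i t) + c * v j t) - (\<Sum>i\<in>S0. d i * v i t))] (mod int p)"
      by (intro cong_add cong_diff S_cong t cong_refl)
    finally show "[(\<Sum>i\<in>I. w' i * v i t) = (\<Sum>i\<in>I. w i * v i t) + c * v j t] (mod int p)"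
      by simp
  qed
qed

text \<open>Single translations compose: each one ends in a coefficient vector over
  \<open>A\<close>, from which the next can start with freshly chosen differences.\<close>

lemma translate_by_span:
  fixes v :: "'i \<Rightarrow> 't \<Rightarrow> int"
  assumes "prime p" "finite I" "finite T" "balanced_mod (int p) A"
    and "\<And>x. \<exists>i\<in>I. int p dvd (\<Sum>t\<in>T. v i t * x t)"
    and "\<And>j. j \<in> I \<Longrightarrow> \<exists>x. \<forall>i\<in>I - {j}. \<not> int p dvd (\<Sum>t\<in>T. v i t * x t)"
    and "w \<in> I \<rightarrow> A" "J \<subseteq> I"
  shows "\<exists>w' \<in> I \<rightarrow> A. \<forall>t\<in>T.
    [(\<Sum>i\<in>I. w' i * v i t) = (\<Sum>i\<in>I. w i * v i t) + (\<Sum>j\<in>J. c j * v j t)] (mod int p)"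
proof -
  have "finite J" using assms by (auto intro: finite_subset)
  then show ?thesis using \<open>J \<subseteq> I\<close>
  proof (induction J rule: finite_induct)
    case empty
    then show ?case using \<open>w \<in> I \<rightarrow> A\<close> by (intro bexI[of _ w]) auto
  next
    case (insert j J)
    then obtain w1 where w1: "w1 \<in> I \<rightarrow> A" "\<And>t. t \<in> T \<Longrightarrow>
        [(\<Sum>i\<in>I. w1 i * v i t) = (\<Sum>i\<in>I. w i * v i t) + (\<Sum>j\<in>J. c j * v j t)] (mod int p)"
      by auto
    have "\<exists>w' \<in> I \<rightarrow> A. \<forall>t\<in>T.
        [(\<Sum>i\<in>I. w' i * v i t) = (\<Sum>i\<in>I. w1 i * v i t) + c j * v j t] (mod int p)"
      using insert.prems by (intro translate_by_element assms w1) auto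
    then obtain w2 where w2: "w2 \<in> I \<rightarrow> A" "\<And>t. t \<in> T \<Longrightarrow>
        [(\<Sum>i\<in>I. w2 i * v i t) = (\<Sum>i\<in>I. w1 i * v i t) + c j * v j t] (mod int p)"
      by blast
    show ?case
    proof (intro bexI[OF _ w2(1)] ballI)
      fix t assume t: "t \<in> T"
      have "[(\<Sum>i\<in>I. w2 i * v i t) =
          (\<Sum>i\<in>I. w i * v i t) + (\<Sum>j\<in>J. c j * v j t) + c j * v j t] (mod int p)"
        using w2(2)[OF t] cong_add[OF w1(2)[OF t] cong_refl] by (rule cong_trans)
      then show "[(\<Sum>i\<in>I. w2 i * v i t) =
          (\<Sum>i\<in>I. w i * v i t) + (\<Sum>j\<in>insert j J. c j * v j t)] (mod int p)"
        using insert.hyps by (simp add: add_ac)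
    qed
  qed
qed

section \<open>Counting coefficient vectors\<close>

text \<open>By independence, the \<open>p ^ card J\<close> combinations of the \<open>v j\<close>
  shift one starting point to distinct points modulo \<open>p\<close>. Each of these points has
  coefficients in \<open>A\<close>, and distinct points need distinct coefficient vectors.\<close>

lemma power_card_le_power_card:
  fixes v :: "'i \<Rightarrow> 't \<Rightarrow> int"
  assumes p: "prime p" and fin: "finite I" "finite T" "finite A" and A: "A \<noteq> {}" "balanced_mod (int p) A"
    and cover: "\<And>x. \<exists>i\<in>I. int p dvd (\<Sum>t\<in>T. v i t * x t)"
    and irr: "\<And>j. j \<in> I \<Longrightarrow> \<exists>x. \<forall>i\<in>I - {j}. \<not> int p dvd (\<Sum>t\<in>T. v i t * x t)"
    and J: "J \<subseteq> I"
    and indep: "\<And>c j. \<forall>t\<in>T. int p dvd (\<Sum>i\<in>J. c i * v i t) \<Longrightarrow> j \<in> J \<Longrightarrow> int p dvd c j"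
  shows "p ^ card J \<le> card A ^ card I"
proof -
  have finJ: "finite J" using J fin by (auto intro: finite_subset)
  obtain a where "a \<in> A" using A by blast
  define w where "w = (\<lambda>_ :: 'i. a)"
  have "\<forall>c. \<exists>w' \<in> I \<rightarrow> A. \<forall>t\<in>T.
      [(\<Sum>i\<in>I. w' i * v i t) = (\<Sum>i\<in>I. w i * v i t) + (\<Sum>j\<in>J. c j * v j t)] (mod int p)"
    using \<open>a \<in> A\<close> by (intro allI translate_by_span p fin A cover irr J) (auto simp: w_def)
  then obtain F where F: "\<And>c. F c \<in> I \<rightarrow> A" "\<And>c t. t \<in> T \<Longrightarrow>
      [(\<Sum>i\<in>I. F c i * v i t) = (\<Sum>i\<in>I. w i * v i t) + (\<Sum>j\<in>J. c j * v j t)] (mod int p)"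
    by metis
  have "inj_on (\<lambda>c. restrict (F c) I) (PiE J (\<lambda>_. {0..<int p}))"
  proof (rule inj_onI)
    fix c e assume c: "c \<in> PiE J (\<lambda>_. {0..<int p})" and e: "e \<in> PiE J (\<lambda>_. {0..<int p})"
      and eq: "restrict (F c) I = restrict (F e) I"
    have "int p dvd (\<Sum>j\<in>J. (c j - e j) * v j t)" if t: "t \<in> T" for t
    proof -
      have "(\<Sum>i\<in>I. F c i * v i t) = (\<Sum>i\<in>I. F e i * v i t)"
      proof (rule sum.cong[OF refl])
        fix i assume "i \<in> I"
        then show "F c i * v i t = F e i * v i t" using fun_cong[OF eq, of i] by simp
      qed
      with F(2)[OF t, of c] F(2)[OF t, of e]
      have "[(\<Sum>i\<in>I. w i * v i t) + (\<Sum>j\<in>J. c j * v j t) =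
          (\<Sum>i\<in>I. w i * v i t) + (\<Sum>j\<in>J. e j * v j t)] (mod int p)"
        unfolding Cong.cong_def by metis
      then show ?thesis
        by (simp add: cong_iff_dvd_diff left_diff_distrib sum_subtractf)
    qed
    then have dvd: "int p dvd c j - e j" if "j \<in> J" for j
      using indep[of "\<lambda>j. c j - e j"] that by blast
    show "c = e"
    proof (rule PiE_ext[OF c e])
      fix j assume j: "j \<in> J"
      then have "c j \<in> {0..<int p}" "e j \<in> {0..<int p}" using c e by auto
      then show "c j = e j"
        using dvd[OF j] by (intro cong_less_imp_eq_int[of _ "int p"]) (auto simp: cong_iff_dvd_diff)
    qed
  qed
  moreover have "(\<lambda>c. restrict (F c) I) ` (PiE J (\<lambda>_. {0..<int p})) \<subseteq> PiE I (\<lambda>_. A)"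
    by (auto intro: funcset_mem[OF F(1)])
  moreover have "finite (PiE I (\<lambda>_. A))" using fin by (intro finite_PiE) auto
  ultimately have "card (PiE J (\<lambda>_. {0..<int p})) \<le> card (PiE I (\<lambda>_. A))"
    by (rule card_inj_on_le)
  then show ?thesis using fin finJ by (simp add: card_PiE)
qed

text \<open>The first component of an index names its block, and the dual vectors \<open>u\<close>
  witness independence within a block. In a minimal subcover \<open>I\<close> some block has at
  least \<open>card I / card L\<close> members; the counting bound for that block yields the claim
  after taking a root of order \<open>card (J l)\<close>. Here \<open>r\<close> is the integer part
  of the binary logarithm of \<open>p\<close>.\<close>

lemma cover_by_independent_blocks:
  fixes v :: "'l \<times> 'b \<Rightarrow> 't \<Rightarrow> int"
  assumes p: "prime p" "p > 2" and fin: "finite V" "finite T" "finite L" and V: "fst ` V \<subseteq> L"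
    and cover: "\<And>x. \<exists>i\<in>V. int p dvd (\<Sum>t\<in>T. v i t * x t)"
    and dual: "\<And>i j. i \<in> V \<Longrightarrow> j \<in> V \<Longrightarrow> fst i = fst j \<Longrightarrow>
      [(\<Sum>t\<in>T. v i t * u j t) = (if i = j then 1 else 0)] (mod int p)"
  shows "\<exists>r. 2 ^ r \<le> p \<and> p < 2 ^ (r + 1) \<and> p \<le> (2 * (r + 1)) ^ card L"
proof -
  obtain A r where A: "balanced_mod (int p) A" "finite A" "A \<noteq> {}"
    "card A \<le> 2 * (r + 1)" "2 ^ r \<le> p" "p < 2 ^ (r + 1)"
    using small_balanced_set[of p] p prime_odd_nat[of p] by auto
  define \<C> where "\<C> = {I. I \<subseteq> V \<and> (\<forall>x. \<exists>i\<in>I. int p dvd (\<Sum>t\<in>T. v i t * x t))}"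
  have "finite \<C>" using fin by (simp add: \<C>_def)
  moreover have "V \<in> \<C>" using cover by (simp add: \<C>_def)
  ultimately obtain I where I: "I \<in> \<C>" and minI: "\<And>I'. I' \<in> \<C> \<Longrightarrow> I' \<subseteq> I \<Longrightarrow> I = I'"
    using finite_has_minimal[of \<C>] by auto
  have cov: "\<exists>i\<in>I. int p dvd (\<Sum>t\<in>T. v i t * x t)" for x using I by (simp add: \<C>_def)
  have IV: "I \<subseteq> V" using I by (simp add: \<C>_def)
  have finI: "finite I" using fin IV by (auto intro: finite_subset)
  have irr: "\<exists>x. \<forall>i\<in>I - {j}. \<not> int p dvd (\<Sum>t\<in>T. v i t * x t)" if "j \<in> I" for j
    using minI[of "I - {j}"] that IV unfolding \<C>_def by blast
  define J where "J l = {i \<in> I. fst i = l}" for l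
  have "I \<noteq> {}" using cov[of "\<lambda>_. 0"] by auto
  have IJ: "I = (\<Union>l\<in>L. J l)" using IV V by (auto simp: J_def)
  then have "L \<noteq> {}" using \<open>I \<noteq> {}\<close> by auto
  obtain l where l: "l \<in> L" "\<And>l'. l' \<in> L \<Longrightarrow> card (J l') \<le> card (J l)"
  proof -
    have "Max ((\<lambda>l. card (J l)) ` L) \<in> (\<lambda>l. card (J l)) ` L"
      using \<open>L \<noteq> {}\<close> fin(3) by (intro Max_in) auto
    then obtain l where "l \<in> L" "Max ((\<lambda>l. card (J l)) ` L) = card (J l)" by auto
    then show thesis using fin(3) by (intro that[of l]) (auto simp flip: \<open>_ = card (J l)\<close>)
  qed
  have "card I \<le> (\<Sum>l\<in>L. card (J l))" unfolding IJ using card_UN_le[OF fin(3)] .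
  also have "\<dots> \<le> card L * card (J l)" using sum_bounded_above[of L, OF l(2)] by simp
  finally have cardI: "card I \<le> card L * card (J l)" .
  \<comment> \<open>Pairing a vanishing combination with the dual vector \<open>u j\<close> isolates
    the coefficient \<open>c j\<close>.\<close>
  have "int p dvd c j" if c: "\<forall>t\<in>T. int p dvd (\<Sum>i\<in>J l. c i * v i t)" and j: "j \<in> J l" for c j
  proof -
    have "(\<Sum>t\<in>T. (\<Sum>i\<in>J l. c i * v i t) * u j t) = (\<Sum>i\<in>J l. c i * (\<Sum>t\<in>T. v i t * u j t))"
      unfolding sum_distrib_left sum_distrib_right by (subst sum.swap) (simp add: mult.assoc)
    also have "[\<dots> = (\<Sum>i\<in>J l. c i * (if i = j then 1 else 0))] (mod int p)"
      using j IV by (intro cong_sum cong_mult dual) (auto simp: J_def)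
    also have "(\<Sum>i\<in>J l. c i * (if i = j then 1 else 0)) = (\<Sum>i\<in>J l. if i = j then c i else 0)"
      by (intro sum.cong) auto
    also have "\<dots> = c j" using j finI by (simp add: J_def)
    finally have "[(\<Sum>t\<in>T. (\<Sum>i\<in>J l. c i * v i t) * u j t) = c j] (mod int p)" .
    moreover have "int p dvd (\<Sum>t\<in>T. (\<Sum>i\<in>J l. c i * v i t) * u j t)"
      using c by (intro dvd_sum) (auto intro: dvd_mult2)
    ultimately show "int p dvd c j" using cong_dvd_iff by blast
  qed
  then have "p ^ card (J l) \<le> card A ^ card I"
    by (intro power_card_le_power_card[of p I T A v] p finI fin A cov irr) (auto simp: J_def)
  also have "\<dots> \<le> card A ^ (card L * card (J l))"
    using A cardI by (intro power_increasing) (auto simp: Suc_le_eq card_gt_0_iff)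
  also have "\<dots> \<le> (2 * (r + 1)) ^ (card L * card (J l))"
    using A by (intro power_mono) auto
  finally have "p ^ card (J l) \<le> ((2 * (r + 1)) ^ card L) ^ card (J l)"
    by (simp only: power_mult)
  moreover have "card (J l) > 0" using cardI \<open>I \<noteq> {}\<close> finI by (auto intro: Nat.gr0I)
  ultimately have "p \<le> (2 * (r + 1)) ^ card L" by simp
  then show ?thesis using A by blast
qed

section \<open>Matrices over the residue ring as integer congruences\<close>

lemma residue_mat_vec_nth:
  assumes "m > 1" "A \<in> carrier_mat n n" "i < n"
  shows "ring_mat_vec (residue_ring m) A x $ i = (\<Sum>j<n. A $$ (i, j) * x $ j) mod m"
proof -
  interpret residues m "residue_ring m" using assms(1) by unfold_locales auto
  have "(\<Oplus>\<^bsub>residue_ring m\<^esub>j\<in>{..<n}. A $$ (i, j) \<otimes>\<^bsub>residue_ring m\<^esub> x $ j) =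
      (\<Sum>j<n. A $$ (i, j) * x $ j) mod m"
    unfolding res_mult_eq by (rule sum_cong) simp
  then show ?thesis using assms(2,3) by (simp add: ring_mat_vec_def)
qed

lemma residue_mat_mult_nth:
  assumes "m > 1" "A \<in> carrier_mat n n" "B \<in> carrier_mat n n" "i < n" "j < n"
  shows "ring_mat_mult (residue_ring m) A B $$ (i, j) = (\<Sum>l<n. A $$ (i, l) * B $$ (l, j)) mod m"
proof -
  interpret residues m "residue_ring m" using assms(1) by unfold_locales auto
  have "(\<Oplus>\<^bsub>residue_ring m\<^esub>l\<in>{..<n}. A $$ (i, l) \<otimes>\<^bsub>residue_ring m\<^esub> B $$ (l, j)) =
      (\<Sum>l<n. A $$ (i, l) * B $$ (l, j)) mod m"
    unfolding res_mult_eq by (rule sum_cong) simp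
  then show ?thesis using assms(2-5) by (simp add: ring_mat_mult_def)
qed

text \<open>The columns of a right inverse are the vectors dual to the rows of \<open>A\<close>, as
  the block argument requires.\<close>

lemma residue_mat_right_inverse:
  assumes "m > 1" "A \<in> Units (mat_monoid (residue_ring m) n)"
  shows "A \<in> carrier_mat n n"
    and "\<exists>B. \<forall>i<n. \<forall>j<n. [(\<Sum>l<n. A $$ (i, l) * B $$ (l, j)) = (if i = j then 1 else 0)] (mod m)"
proof -
  interpret residues m "residue_ring m" using assms(1) by unfold_locales auto
  obtain B where AB: "A \<in> carrier_mat n n" "B \<in> carrier_mat n n"
      "ring_mat_mult (residue_ring m) A B = ring_mat_one (residue_ring m) n"
    using assms(2) by (auto simp: Units_def mat_monoid_def ring_mats_def)
  show "A \<in> carrier_mat n n" by fact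
  have "[(\<Sum>l<n. A $$ (i, l) * B $$ (l, j)) = (if i = j then 1 else 0)] (mod m)"
    if "i < n" "j < n" for i j
    using residue_mat_mult_nth[OF assms(1) AB(1,2) that] that assms(1)
    by (simp add: AB(3) ring_mat_one_def res_one_eq res_zero_eq Cong.cong_def split: if_splits)
  then show "\<exists>B. \<forall>i<n. \<forall>j<n.
      [(\<Sum>l<n. A $$ (i, l) * B $$ (l, j)) = (if i = j then 1 else 0)] (mod m)"
    by blast
qed

theorem theorem1p3:
  fixes k :: nat
  assumes "k \<ge> 2"
  shows "\<exists>p0 :: nat. \<forall>n :: nat. n > 0 \<longrightarrow>
    (\<forall>(p :: nat) (M :: nat \<Rightarrow> int mat).
       prime p \<longrightarrow> p > p0 \<longrightarrow>
       (\<forall>i\<in>{1..k}. M i \<in> Units (mat_monoid (residue_ring (int p)) n)) \<longrightarrow>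
       (\<exists>x \<in> ring_vecs (residue_ring (int p)) n.
          \<forall>i\<in>{1..k}. \<forall>j<n.
            ring_mat_vec (residue_ring (int p)) (M i) x $ j \<noteq> \<zero>\<^bsub>residue_ring (int p)\<^esub>))"
proof -
  have "\<forall>\<^sub>F r :: nat in at_top. (2 * (real r + 1)) ^ k < 2 ^ r"
    by real_asymp
  then obtain r0 where r0: "\<And>r :: nat. r \<ge> r0 \<Longrightarrow> (2 * (real r + 1)) ^ k < 2 ^ r"
    by (auto simp: eventually_at_top_linorder)
  have "\<exists>x \<in> ring_vecs (residue_ring (int p)) n. \<forall>i\<in>{1..k}. \<forall>j<n.
      ring_mat_vec (residue_ring (int p)) (M i) x $ j \<noteq> \<zero>\<^bsub>residue_ring (int p)\<^esub>"
    if p: "prime p" "p > 2 ^ (r0 + 1)"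
      and M: "\<forall>i\<in>{1..k}. M i \<in> Units (mat_monoid (residue_ring (int p)) n)"
    for n p :: nat and M :: "nat \<Rightarrow> int mat"
  proof (rule ccontr)
    assume neg: "\<not> ?thesis"
    have p1: "int p > 1" using prime_gt_1_nat[OF p(1)] by simp
    interpret residues "int p" "residue_ring (int p)" using p1 by unfold_locales auto
    have Mc: "M i \<in> carrier_mat n n" if "i \<in> {1..k}" for i
      using residue_mat_right_inverse(1)[OF p1] M that by blast
    have "\<forall>i\<in>{1..k}. \<exists>B. \<forall>a<n. \<forall>b<n.
        [(\<Sum>l<n. M i $$ (a, l) * B $$ (l, b)) = (if a = b then 1 else 0)] (mod int p)"
      using residue_mat_right_inverse(2)[OF p1] M by blast
    then obtain B where B: "\<And>i a b. i \<in> {1..k} \<Longrightarrow> a < n \<Longrightarrow> b < n \<Longrightarrow>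
        [(\<Sum>l<n. M i $$ (a, l) * B i $$ (l, b)) = (if a = b then 1 else 0)] (mod int p)"
      by metis
    \<comment> \<open>An index is a pair of a matrix and a row number: \<open>v\<close> lists the
      rows and \<open>u\<close> the columns of the right inverses, so each matrix forms one
      block.\<close>
    define V where "V = {1..k} \<times> {..<n}"
    define v where "v i t = M (fst i) $$ (snd i, t)" for i :: "nat \<times> nat" and t
    define u where "u i t = B (fst i) $$ (t, snd i)" for i :: "nat \<times> nat" and t
    have "\<exists>r. 2 ^ r \<le> p \<and> p < 2 ^ (r + 1) \<and> p \<le> (2 * (r + 1)) ^ card {1..k}"
    proof (rule cover_by_independent_blocks[of p V "{..<n}" "{1..k}" v u])
      have "(2 :: nat) \<le> 2 ^ (r0 + 1)" by simp
      then show "p > 2" using p(2) by (rule le_less_trans)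
      show "fst ` V \<subseteq> {1..k}" by (auto simp: V_def)
      show "\<exists>i\<in>V. int p dvd (\<Sum>t<n. v i t * x t)" for x
      proof -
        \<comment> \<open>The covering condition concerns all integer vectors, while
          \<open>neg\<close> speaks of vectors of residues; hence the reduction modulo
          \<open>p\<close>.\<close>
        define y where "y = vec n (\<lambda>t. x t mod int p)"
        have "y \<in> ring_vecs (residue_ring (int p)) n"
          using p1 by (auto simp: y_def ring_vecs_def res_carrier_eq)
        then obtain l j where lj: "l \<in> {1..k}" "j < n"
            "ring_mat_vec (residue_ring (int p)) (M l) y $ j = \<zero>\<^bsub>residue_ring (int p)\<^esub>"
          using neg by blast
        then have "int p dvd (\<Sum>t<n. M l $$ (j, t) * y $ t)"
          using residue_mat_vec_nth[OF p1 Mc[OF lj(1)] lj(2), of y] by (simp add: res_zero_eq dvd_eq_mod_eq_0)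
        moreover have "[(\<Sum>t<n. M l $$ (j, t) * y $ t) = (\<Sum>t<n. v (l, j) t * x t)] (mod int p)"
          unfolding v_def y_def by (intro cong_sum cong_mult) (auto simp: Cong.cong_def)
        ultimately have "int p dvd (\<Sum>t<n. v (l, j) t * x t)" using cong_dvd_iff by blast
        then show ?thesis using lj by (auto simp: V_def)
      qed
      show "[(\<Sum>t<n. v i t * u j t) = (if i = j then 1 else 0)] (mod int p)"
        if "i \<in> V" "j \<in> V" "fst i = fst j" for i j
        using B[of "fst i" "snd i" "snd j"] that by (auto simp: V_def v_def u_def prod_eq_iff)
    qed (use p in \<open>auto simp: V_def\<close>)
    then obtain r where r: "2 ^ r \<le> p" "p < 2 ^ (r + 1)" "p \<le> (2 * (r + 1)) ^ k" by auto
    \<comment> \<open>The threshold \<open>2 ^ (r0 + 1)\<close> forces \<open>r > r0\<close>, where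
      the exponential beats the polynomial:
      \<open>p \<le> (2 * (r + 1)) ^ k < 2 ^ r \<le> p\<close>.\<close>
    have "(2 :: nat) ^ (r0 + 1) < 2 ^ (r + 1)" using p(2) r(2) by (rule less_trans)
    then have "(2 * (real r + 1)) ^ k < 2 ^ r" by (intro r0) simp
    then have "real ((2 * (r + 1)) ^ k) < real (2 ^ r)" by (simp add: add.commute)
    then have "(2 * (r + 1)) ^ k < 2 ^ r" by (simp only: of_nat_less_iff)
    then show False using r by linarith
  qed
  then show ?thesis by blast
qed

end
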